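(* For every real $p$ with $1<p<2$, $$p<\left(\frac{p}{p-1}\right)^{p-1}$$ and $$(p-1)^{1-p}\left(1+\frac{\pi^2}{6}(p-1)\right)^{p-1}<p+\frac{\pi^2}{6}-1.$$ *)

theory Defs
  imports "HOL-Analysis.Analysis"
begin

end

theory Submission
  imports Defs
begin

text \<open>
  Put \<open>x = p - 1\<close>, so that \<open>0 < x < 1\<close>, and take logarithms.

  The first inequality becomes \<open>(1 - x) * ln (1 + x) + x * ln x < 0\<close>. It follows from the tangent
  bounds \<open>ln (1 + x) < x\<close> and \<open>ln x \<le> x - 1\<close>, whose contributions cancel.

  The second inequality becomes \<open>F x < 0\<close>, where \<open>c = pi\<^sup>2 / 6\<close> and
  \<open>F x = x * (ln (1 + c * x) - ln x) - ln (x + c)\<close>. Here \<open>F 1 = 0\<close>, and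
  \<open>F'' x = 1 / (x + c)\<^sup>2 - 1 / (x * (1 + c * x)\<^sup>2)\<close> is negative on \<open>(0, 1)\<close> as soon as \<open>c \<ge> 1\<close>.
  So \<open>F\<close> is concave there, and if \<open>F' 1 = ln (1 + c) - 2 / (1 + c)\<close> is positive then \<open>F\<close> increases
  to its value \<open>0\<close> at \<open>1\<close>. The condition \<open>F' 1 > 0\<close> holds for all \<open>c \<ge> 3/2\<close>, and
  \<open>pi > 3\<close> gives \<open>pi\<^sup>2 / 6 > 3/2\<close>.
\<close>

lemma one_plus_less_powr:
  fixes x :: real
  assumes "0 < x" "x < 1"
  shows "1 + x < ((1 + x) / x) powr x"
proof -
  have "(1 - x) * ln (1 + x) < (1 - x) * x"
    using assms ln_add_one_self_less_self[of x] by (intro mult_strict_left_mono) auto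
  moreover have "x * ln x \<le> x * (x - 1)"
    using assms ln_le_minus_one[of x] by (intro mult_left_mono) auto
  ultimately have "ln (1 + x) < x * ln ((1 + x) / x)"
    using assms by (simp add: ln_div algebra_simps)
  hence "exp (ln (1 + x)) < exp (x * ln ((1 + x) / x))"
    by (simp only: exp_less_cancel_iff)
  thus ?thesis
    using assms by (simp add: powr_def)
qed

text \<open>The expression shown to be positive is \<open>F' x\<close>. It exceeds \<open>F' 1\<close>, which is positive by
  \<open>end_slope\<close>, because \<open>F'\<close> is strictly decreasing on \<open>(0, 1]\<close>.\<close>

lemma log_difference_derivative_pos:
  fixes c x :: real
  assumes c: "1 \<le> c" and end_slope: "2 / (1 + c) < ln (1 + c)" and x: "0 < x" "x < 1"
  shows "0 < ln (1 + c * x) - ln x - 1 / (1 + c * x) - 1 / (x + c)"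
proof -
  let ?G = "\<lambda>t. ln (1 + c * t) - ln t - 1 / (1 + c * t) - 1 / (t + c)"
  have deriv: "(?G has_real_derivative 1 / (t + c)\<^sup>2 - 1 / (t * (1 + c * t)\<^sup>2)) (at t)"
    if t: "0 < t" for t
  proof -
    have pos: "0 < 1 + c * t" "0 < t + c"
      using c t by (auto intro: add_pos_pos)
    have "(?G has_real_derivative
        c / (1 + c * t) - 1 / t + c / (1 + c * t)\<^sup>2 + 1 / (t + c)\<^sup>2) (at t)"
      using t pos
      by (auto intro!: derivative_eq_intros simp: power2_eq_square)
    moreover have "c / (1 + c * t) - 1 / t + c / (1 + c * t)\<^sup>2 = - (1 / (t * (1 + c * t)\<^sup>2))"
    proof -
      have "c / y - 1 / t + c / y\<^sup>2 = - (1 / (t * y\<^sup>2))" if "y = 1 + c * t" "y > 0" for y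
        using t that(2) by (simp add: field_simps power2_eq_square) (simp add: that(1) algebra_simps)
      thus ?thesis using pos by blast
    qed
    ultimately show ?thesis by simp
  qed
  have neg: "1 / (t + c)\<^sup>2 - 1 / (t * (1 + c * t)\<^sup>2) < 0" if t: "0 < t" "t < 1" for t
  proof -
    have pos: "0 < 1 + c * t" "0 < t + c"
      using c t by (auto intro: add_pos_pos)
    have "0 \<le> (c - 1) * (1 - t)" using c t by simp
    hence "1 + c * t \<le> t + c" by (simp add: algebra_simps)
    hence "(1 + c * t)\<^sup>2 \<le> (t + c)\<^sup>2" using pos by (intro power_mono) auto
    moreover have "t * (1 + c * t)\<^sup>2 < (1 + c * t)\<^sup>2" using t pos by simp
    ultimately have "t * (1 + c * t)\<^sup>2 < (t + c)\<^sup>2" by linarith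
    moreover have "0 < t * (1 + c * t)\<^sup>2" using t pos by simp
    ultimately have "1 / (t + c)\<^sup>2 < 1 / (t * (1 + c * t)\<^sup>2)"
      by (intro divide_strict_left_mono) (use pos in auto)
    thus ?thesis by simp
  qed
  have "?G 1 < ?G x"
  proof (rule DERIV_neg_imp_decreasing_open[OF x(2)])
    show "\<exists>y. (?G has_real_derivative y) (at t) \<and> y < 0" if "x < t" "t < 1" for t
      using deriv[of t] neg[of t] that x by (meson less_trans)
    show "continuous_on {x..1} ?G"
      using deriv x by (intro DERIV_continuous_on[where D = "\<lambda>t. 1 / (t + c)\<^sup>2 - 1 / (t * (1 + c * t)\<^sup>2)"])
        (auto intro: has_field_derivative_at_within)
  qed
  moreover have "0 < ?G 1" using end_slope by (simp add: add.commute)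
  ultimately show ?thesis by linarith
qed

lemma powr_less_add:
  fixes c x :: real
  assumes c: "1 \<le> c" and end_slope: "2 / (1 + c) < ln (1 + c)" and x: "0 < x" "x < 1"
  shows "((1 + c * x) / x) powr x < x + c"
proof -
  let ?F = "\<lambda>t. t * (ln (1 + c * t) - ln t) - ln (t + c)"
  have deriv: "(?F has_real_derivative
      ln (1 + c * t) - ln t - 1 / (1 + c * t) - 1 / (t + c)) (at t)" if t: "0 < t" for t
  proof -
    have pos: "0 < 1 + c * t" "0 < t + c"
      using c t by (auto intro: add_pos_pos)
    have "(?F has_real_derivative
        (ln (1 + c * t) - ln t) + t * (c / (1 + c * t) - 1 / t) - 1 / (t + c)) (at t)"
      using t pos by (auto intro!: derivative_eq_intros)
    moreover have "t * (c / (1 + c * t) - 1 / t) = - (1 / (1 + c * t))"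
    proof -
      have "t * (c / y - 1 / t) = - (1 / y)" if "y = 1 + c * t" "y > 0" for y
        using t that(2) by (simp add: field_simps) (simp add: that(1) algebra_simps)
      thus ?thesis using pos by blast
    qed
    ultimately show ?thesis by simp
  qed
  have "?F x < ?F 1"
  proof (rule DERIV_pos_imp_increasing_open[OF x(2)])
    show "\<exists>y. (?F has_real_derivative y) (at t) \<and> y > 0" if "x < t" "t < 1" for t
      using deriv[of t] log_difference_derivative_pos[OF c end_slope, of t] that x
      by (meson less_trans)
    show "continuous_on {x..1} ?F"
      using deriv x
      by (intro DERIV_continuous_on[where
            D = "\<lambda>t. ln (1 + c * t) - ln t - 1 / (1 + c * t) - 1 / (t + c)"])
        (auto intro: has_field_derivative_at_within)
  qed
  moreover have pos: "0 < 1 + c * x" "0 < x + c"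
    using c x by (auto intro: add_pos_pos)
  ultimately have "x * ln ((1 + c * x) / x) < ln (x + c)"
    using x by (simp add: ln_div)
  hence "exp (x * ln ((1 + c * x) / x)) < exp (ln (x + c))"
    by (simp only: exp_less_cancel_iff)
  thus ?thesis
    using pos x by (simp add: powr_def)
qed

lemma two_div_less_ln:
  fixes u :: real
  assumes "5/2 \<le> u"
  shows "2 / u < ln u"
proof -
  \<comment> \<open>\<open>exp 1 \<le> 3\<close> suffices, since \<open>3 ^ 4 < (5/2) ^ 5\<close> means that \<open>4/5 * ln 3 < ln (5/2)\<close>.\<close>
  have "1 \<le> ln (3 :: real)"
    using exp_le by (simp add: ln_ge_iff)
  hence "4 \<le> ln ((3 :: real) ^ 4)"
    by (subst ln_realpow) auto
  also have "\<dots> < ln ((5/2 :: real) ^ 5)"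
    by (subst ln_less_cancel_iff) (auto simp: power_numeral_even power_numeral_odd)
  also have "\<dots> = 5 * ln (5/2)"
    by (subst ln_realpow) auto
  finally have "4/5 < ln (5/2 :: real)" by simp
  moreover have "2 / u \<le> 4/5" using assms by (simp add: field_simps)
  moreover have "ln (5/2) \<le> ln u" using assms by (subst ln_le_cancel_iff) auto
  ultimately show ?thesis by linarith
qed

theorem lemma1p3:
  fixes p :: real
  assumes "1 < p" and "p < 2"
  shows "p < (p / (p - 1)) powr (p - 1) \<and>
    (p - 1) powr (1 - p) * (1 + pi\<^sup>2 / 6 * (p - 1)) powr (p - 1) < p + pi\<^sup>2 / 6 - 1"
proof
  define x where "x = p - 1"
  define c :: real where "c = pi\<^sup>2 / 6"
  have x: "0 < x" "x < 1" and p: "p = 1 + x"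
    using assms by (auto simp: x_def)
  show "p < (p / (p - 1)) powr (p - 1)"
    using one_plus_less_powr[OF x] by (simp add: p)
  have "(3 :: real)\<^sup>2 < pi\<^sup>2"
    using pi_gt3 by (intro power_strict_mono) auto
  hence c: "3/2 \<le> c" by (simp add: c_def)
  have pos: "0 < 1 + c * x" using c x by (auto intro: add_pos_pos)
  have "((1 + c * x) / x) powr x < x + c"
    using c x two_div_less_ln[of "1 + c"] by (intro powr_less_add) auto
  moreover have "((1 + c * x) / x) powr x = x powr (- x) * (1 + c * x) powr x"
    using x pos by (simp add: powr_divide powr_minus field_simps)
  ultimately have "x powr (- x) * (1 + c * x) powr x < x + c"
    by simp
  thus "(p - 1) powr (1 - p) * (1 + pi\<^sup>2 / 6 * (p - 1)) powr (p - 1) < p + pi\<^sup>2 / 6 - 1"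
    by (simp add: p c_def)
qed

end
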